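(* Let $C\ge 2$ and let $\pi_i^L\le\pi_i^U$, $\tau_i^L\le\tau_i^U$, $\alpha_i^L\le\alpha_i^U$ ($i=1,\dots,C-1$) be the lower and upper bounds for cumulative probabilities described in the context. Let $$U=\max_{\pi,\tau,\alpha}\left(\max_{i=1,\dots,C-1}|\pi_i-\alpha_i|-\max_{i=1,\dots,C-1}|\tau_i-\alpha_i|\right),$$ where the maximum is over all cumulative distributions $\pi,\tau,\alpha$ with $\pi_i^L\le\pi_i\le\pi_i^U$, $\tau_i^L\le\tau_i\le\tau_i^U$, $\alpha_i^L\le\alpha_i\le\alpha_i^U$, $i=1,\dots,C-1$; that is, $U$ is the upper bound for $D_{KS}(P,Q)-D_{KS}(R,Q)$. Then $U$ is determined by solving the following $2(C-1)$ linear programming problems: $$U_1(k)=\max_{B,\tau,\alpha}\left(\pi_k^U-\alpha_k-B\right),\qquad U_2(k)=\max_{B,\tau,\alpha}\left(\alpha_k-\pi_k^L-B\right),\qquad k=1,\dots,C-1,$$ all subject to $$\tau_i^L\le\tau_i\le\tau_i^U,\quad \alpha_i^L\le\alpha_i\le\alpha_i^U,\quad i=1,\dots,C-1,$$ $$B\ge\tau_i-\alpha_i,\quad B\ge\alpha_i-\tau_i,\quad i=1,\dots,C-1,$$ $$\tau_i\le\tau_{i+1},\quad \alpha_i\le\alpha_{i+1},\quad i=1,\dots,C-2,$$ where for $U_1(k)$ the following constraints are added: $$\alpha_k\le\pi_k^U\quad\text{and}\quad \pi_k^U-\alpha_k\ge\pi_i^U-\alpha_i,\quad i=1,\dots,C-1,\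 i\ne k,$$ and for $U_2(k)$ the following constraints are added: $$\alpha_k\ge\pi_k^L\quad\text{and}\quad \alpha_k-\pi_k^L\ge\alpha_i-\pi_i^L,\quad i=1,\dots,C-1,\ i\ne k.$$ The final solution is determined by selecting $k_1=\arg\max_k(\pi_k^U-\alpha_k)$ from the problems $U_1(k)$ and $k_2=\arg\max_k(\alpha_k-\pi_k^L)$ from the problems $U_2(k)$, where in each case $\alpha_k$ is the value at the optimal solution of the $k$-th problem, and $$U=\begin{cases}U_1(k_1), & \text{if } \pi_{k_1}^U-\alpha_{k_1}\ge\alpha_{k_2}-\pi_{k_2}^L,\\ U_2(k_2), & \text{otherwise.}\end{cases}$$
   Context: For probability distributions $P=(p_1,\dots,p_C)$ and $Q=(q_1,\dots,q_C)$ on $C$ classes with cumulative distributions $\pi_i=\sum_{j\le i}p_j$, $\alpha_i=\sum_{j\le i}q_j$ (so $\pi_C=\alpha_C=1$), the Kolmogorov-Smirnov distance is $D_{KS}(P,Q)=\max_{i=1,\dots,C-1}|\pi_i-\alpha_i|$. Cumulative distributions are nondecreasing in $i$, with last entry (index $C$) equal to $1$. Three fixed probability distributions $P_S,P_{S,i},P_N$ on $C$ classes and a number $\varepsilon\in[0,1]$ are given. The imprecise $\varepsilon$-contamination model replaces a distribution $P$ by the set of distributions $P^*=(1-\varepsilon)P+\varepsilon H$, with $H$ an arbitrary distribution, so that the probability of an event $A$ is bounded by $(1-\varepsilon)P(A)\le P^*(A)\le(1-\varepsilon)P(A)+\varepsilon$. Taking $A=\{1,\dots,i\}$ gives bounds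 for the $i$-th cumulative probability. The letters $\pi$ (for $P$), $\tau$ (for $R$), $\alpha$ (for $Q$) denote cumulative distributions in the sets produced by the model from $P_S$, $P_{S,i}$, $P_N$ respectively, and $[\pi_i^L,\pi_i^U]$, $[\tau_i^L,\tau_i^U]$, $[\alpha_i^L,\alpha_i^U]$ are the corresponding bounds; e.g. $\pi_i^L=(1-\varepsilon)P_S(\{1,\dots,i\})$, $\pi_i^U=(1-\varepsilon)P_S(\{1,\dots,i\})+\varepsilon$. Some of the linear programs may have no solution, for example $U_1(k)$ when $\pi_k^U<\alpha_k^L$, and $U_2(k)$ when $\pi_k^L>\alpha_k^U$; such problems are disregarded in the selection.
   Formalization: Optimal solutions need not be unique, and the rule can fail for arbitrary ones; here each program uses an optimal solution with least gap (π_k^U−α_k, resp. α_k−π_k^L), and ties in the arg max are broken by larger program value. *)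

theory Defs
  imports "HOL-Probability.Probability"
begin

text \<open>
  The classes are \<open>1, \<dots>, C\<close>; a distribution on them is a \<open>nat pmf\<close> supported in \<open>{1..C}\<close>.
  Sequences indexed by classes are functions on \<open>nat\<close>, of which only the values at the relevant
  indices are ever inspected.
\<close>

definition cum_prob :: "nat pmf \<Rightarrow> nat \<Rightarrow> real" where
  "cum_prob P i = measure_pmf.prob P {1..i}"

definition cum_lower :: "real \<Rightarrow> nat pmf \<Rightarrow> nat \<Rightarrow> real" where
  "cum_lower \<epsilon> P i = (1 - \<epsilon>) * cum_prob P i"

definition cum_upper :: "real \<Rightarrow> nat pmf \<Rightarrow> nat \<Rightarrow> real" where
  "cum_upper \<epsilon> P i = (1 - \<epsilon>) * cum_prob P i + \<epsilon>"

definition cumulative_distribution :: "nat \<Rightarrow> (nat \<Rightarrow> real) \<Rightarrow> bool" where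
  "cumulative_distribution C F \<longleftrightarrow> 0 \<le> F 1 \<and> mono_on {1..C} F \<and> F C = 1"

definition within_bounds :: "nat \<Rightarrow> real \<Rightarrow> nat pmf \<Rightarrow> (nat \<Rightarrow> real) \<Rightarrow> bool" where
  "within_bounds C \<epsilon> P F \<longleftrightarrow> (\<forall>i\<in>{1..C-1}. cum_lower \<epsilon> P i \<le> F i \<and> F i \<le> cum_upper \<epsilon> P i)"

definition ks_dist :: "nat \<Rightarrow> (nat \<Rightarrow> real) \<Rightarrow> (nat \<Rightarrow> real) \<Rightarrow> real" where
  "ks_dist C F G = (MAX i\<in>{1..C-1}. \<bar>F i - G i\<bar>)"


subsection \<open>The problem defining \<open>U\<close>\<close>

text \<open>Its points are triples \<open>(\<pi>, \<tau>, \<alpha>)\<close>.\<close>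

definition ks_diff :: "nat \<Rightarrow> (nat \<Rightarrow> real) \<times> (nat \<Rightarrow> real) \<times> (nat \<Rightarrow> real) \<Rightarrow> real" where
  "ks_diff C = (\<lambda>(\<pi>, \<tau>, \<alpha>). ks_dist C \<pi> \<alpha> - ks_dist C \<tau> \<alpha>)"

definition U_feasible ::
  "nat \<Rightarrow> real \<Rightarrow> nat pmf \<Rightarrow> nat pmf \<Rightarrow> nat pmf
    \<Rightarrow> (nat \<Rightarrow> real) \<times> (nat \<Rightarrow> real) \<times> (nat \<Rightarrow> real) \<Rightarrow> bool" where
  "U_feasible C \<epsilon> P\<^sub>S P\<^sub>S\<^sub>i P\<^sub>N = (\<lambda>(\<pi>, \<tau>, \<alpha>).
     cumulative_distribution C \<pi> \<and> within_bounds C \<epsilon> P\<^sub>S \<pi> \<and>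
     cumulative_distribution C \<tau> \<and> within_bounds C \<epsilon> P\<^sub>S\<^sub>i \<tau> \<and>
     cumulative_distribution C \<alpha> \<and> within_bounds C \<epsilon> P\<^sub>N \<alpha>)"


subsection \<open>The linear programs\<close>

text \<open>Their points are triples \<open>(B, \<tau>, \<alpha>)\<close>.\<close>

type_synonym lp_point = "real \<times> (nat \<Rightarrow> real) \<times> (nat \<Rightarrow> real)"

definition common_constraints ::
  "nat \<Rightarrow> real \<Rightarrow> nat pmf \<Rightarrow> nat pmf \<Rightarrow> lp_point \<Rightarrow> bool" where
  "common_constraints C \<epsilon> P\<^sub>S\<^sub>i P\<^sub>N = (\<lambda>(B, \<tau>, \<alpha>).
     within_bounds C \<epsilon> P\<^sub>S\<^sub>i \<tau> \<and> within_bounds C \<epsilon> P\<^sub>N \<alpha> \<and>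
     (\<forall>i\<in>{1..C-1}. B \<ge> \<tau> i - \<alpha> i \<and> B \<ge> \<alpha> i - \<tau> i) \<and>
     (\<forall>i\<in>{1..C-2}. \<tau> i \<le> \<tau> (i + 1) \<and> \<alpha> i \<le> \<alpha> (i + 1)))"

definition U1_feasible ::
  "nat \<Rightarrow> real \<Rightarrow> nat pmf \<Rightarrow> nat pmf \<Rightarrow> nat pmf \<Rightarrow> nat \<Rightarrow> lp_point \<Rightarrow> bool" where
  "U1_feasible C \<epsilon> P\<^sub>S P\<^sub>S\<^sub>i P\<^sub>N k = (\<lambda>(B, \<tau>, \<alpha>).
     common_constraints C \<epsilon> P\<^sub>S\<^sub>i P\<^sub>N (B, \<tau>, \<alpha>) \<and>
     \<alpha> k \<le> cum_upper \<epsilon> P\<^sub>S k \<and>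
     (\<forall>i\<in>{1..C-1}. i \<noteq> k \<longrightarrow> cum_upper \<epsilon> P\<^sub>S k - \<alpha> k \<ge> cum_upper \<epsilon> P\<^sub>S i - \<alpha> i))"

definition U2_feasible ::
  "nat \<Rightarrow> real \<Rightarrow> nat pmf \<Rightarrow> nat pmf \<Rightarrow> nat pmf \<Rightarrow> nat \<Rightarrow> lp_point \<Rightarrow> bool" where
  "U2_feasible C \<epsilon> P\<^sub>S P\<^sub>S\<^sub>i P\<^sub>N k = (\<lambda>(B, \<tau>, \<alpha>).
     common_constraints C \<epsilon> P\<^sub>S\<^sub>i P\<^sub>N (B, \<tau>, \<alpha>) \<and>
     \<alpha> k \<ge> cum_lower \<epsilon> P\<^sub>S k \<and>
     (\<forall>i\<in>{1..C-1}. i \<noteq> k \<longrightarrow> \<alpha> k - cum_lower \<epsilon> P\<^sub>S k \<ge> \<alpha> i - cum_lower \<epsilon> P\<^sub>S i))"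

definition U1_gap :: "real \<Rightarrow> nat pmf \<Rightarrow> nat \<Rightarrow> lp_point \<Rightarrow> real" where
  "U1_gap \<epsilon> P\<^sub>S k = (\<lambda>(B, \<tau>, \<alpha>). cum_upper \<epsilon> P\<^sub>S k - \<alpha> k)"

definition U2_gap :: "real \<Rightarrow> nat pmf \<Rightarrow> nat \<Rightarrow> lp_point \<Rightarrow> real" where
  "U2_gap \<epsilon> P\<^sub>S k = (\<lambda>(B, \<tau>, \<alpha>). \<alpha> k - cum_lower \<epsilon> P\<^sub>S k)"

definition U1_obj :: "real \<Rightarrow> nat pmf \<Rightarrow> nat \<Rightarrow> lp_point \<Rightarrow> real" where
  "U1_obj \<epsilon> P\<^sub>S k = (\<lambda>(B, \<tau>, \<alpha>). cum_upper \<epsilon> P\<^sub>S k - \<alpha> k - B)"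

definition U2_obj :: "real \<Rightarrow> nat pmf \<Rightarrow> nat \<Rightarrow> lp_point \<Rightarrow> real" where
  "U2_obj \<epsilon> P\<^sub>S k = (\<lambda>(B, \<tau>, \<alpha>). \<alpha> k - cum_lower \<epsilon> P\<^sub>S k - B)"

definition U1_solvable ::
  "nat \<Rightarrow> real \<Rightarrow> nat pmf \<Rightarrow> nat pmf \<Rightarrow> nat pmf \<Rightarrow> nat \<Rightarrow> bool" where
  "U1_solvable C \<epsilon> P\<^sub>S P\<^sub>S\<^sub>i P\<^sub>N k \<longleftrightarrow> k \<in> {1..C-1} \<and> (\<exists>x. U1_feasible C \<epsilon> P\<^sub>S P\<^sub>S\<^sub>i P\<^sub>N k x)"

definition U2_solvable ::
  "nat \<Rightarrow> real \<Rightarrow> nat pmf \<Rightarrow> nat pmf \<Rightarrow> nat pmf \<Rightarrow> nat \<Rightarrow> bool" where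
  "U2_solvable C \<epsilon> P\<^sub>S P\<^sub>S\<^sub>i P\<^sub>N k \<longleftrightarrow> k \<in> {1..C-1} \<and> (\<exists>x. U2_feasible C \<epsilon> P\<^sub>S P\<^sub>S\<^sub>i P\<^sub>N k x)"


subsection \<open>Optimal solutions and the selection rule\<close>

text \<open>
  The selection rule compares the gaps \<open>\<pi>\<^sub>k\<^sup>U - \<alpha>\<^sub>k\<close> and \<open>\<alpha>\<^sub>k - \<pi>\<^sub>k\<^sup>L\<close> at \<^emph>\<open>the\<close> optimal solution of
  each program, but a program may have several optimal solutions with different gaps, and for
  arbitrary ones the rule can select a program whose optimal value is smaller than \<open>U\<close>.
  Example with \<open>C = 3\<close>, \<open>\<epsilon> = 0.3\<close> and lower cumulative bounds \<open>\<pi>\<^sup>L = (0.3, 0.65)\<close>,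
  \<open>\<tau>\<^sup>L = (0.4, 0.5)\<close>, \<open>\<alpha>\<^sup>L = (0.1, 0.5)\<close>: in \<open>U\<^sub>1(1)\<close> the optimal value is \<open>0.2\<close>, and it is attained
  at \<open>\<alpha> = (0.1, 0.5)\<close> with gap \<open>0.5\<close>; in \<open>U\<^sub>1(2)\<close> the optimal value \<open>0.45\<close> comes with gap at most
  \<open>0.45\<close>. Two conventions settle the degenerate cases:

    \<^item> among the optimal solutions of a program, one with the least gap is used;
    \<^item> among the indices with the largest gap, one whose program has the largest value is used.

  If all optimal solutions of each program have the same \<open>\<alpha>\<^sub>k\<close>, the first convention is void;
  if the maximizing index is unique, so is the second.
\<close>

definition U1_solution ::
  "nat \<Rightarrow> real \<Rightarrow> nat pmf \<Rightarrow> nat pmf \<Rightarrow> nat pmf \<Rightarrow> nat \<Rightarrow> lp_point \<Rightarrow> bool" where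
  "U1_solution C \<epsilon> P\<^sub>S P\<^sub>S\<^sub>i P\<^sub>N k x \<longleftrightarrow>
     is_arg_min (U1_gap \<epsilon> P\<^sub>S k) (is_arg_max (U1_obj \<epsilon> P\<^sub>S k) (U1_feasible C \<epsilon> P\<^sub>S P\<^sub>S\<^sub>i P\<^sub>N k)) x"

definition U2_solution ::
  "nat \<Rightarrow> real \<Rightarrow> nat pmf \<Rightarrow> nat pmf \<Rightarrow> nat pmf \<Rightarrow> nat \<Rightarrow> lp_point \<Rightarrow> bool" where
  "U2_solution C \<epsilon> P\<^sub>S P\<^sub>S\<^sub>i P\<^sub>N k x \<longleftrightarrow>
     is_arg_min (U2_gap \<epsilon> P\<^sub>S k) (is_arg_max (U2_obj \<epsilon> P\<^sub>S k) (U2_feasible C \<epsilon> P\<^sub>S P\<^sub>S\<^sub>i P\<^sub>N k)) x"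

text \<open>Below, \<open>s k\<close> is the solution used for the \<open>k\<close>-th program.\<close>

definition U1_selected ::
  "nat \<Rightarrow> real \<Rightarrow> nat pmf \<Rightarrow> nat pmf \<Rightarrow> nat pmf \<Rightarrow> (nat \<Rightarrow> lp_point) \<Rightarrow> nat \<Rightarrow> bool" where
  "U1_selected C \<epsilon> P\<^sub>S P\<^sub>S\<^sub>i P\<^sub>N s k\<^sub>1 \<longleftrightarrow>
     is_arg_max (\<lambda>k. U1_obj \<epsilon> P\<^sub>S k (s k))
       (is_arg_max (\<lambda>k. U1_gap \<epsilon> P\<^sub>S k (s k)) (U1_solvable C \<epsilon> P\<^sub>S P\<^sub>S\<^sub>i P\<^sub>N)) k\<^sub>1"

definition U2_selected ::
  "nat \<Rightarrow> real \<Rightarrow> nat pmf \<Rightarrow> nat pmf \<Rightarrow> nat pmf \<Rightarrow> (nat \<Rightarrow> lp_point) \<Rightarrow> nat \<Rightarrow> bool" where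
  "U2_selected C \<epsilon> P\<^sub>S P\<^sub>S\<^sub>i P\<^sub>N s k\<^sub>2 \<longleftrightarrow>
     is_arg_max (\<lambda>k. U2_obj \<epsilon> P\<^sub>S k (s k))
       (is_arg_max (\<lambda>k. U2_gap \<epsilon> P\<^sub>S k (s k)) (U2_solvable C \<epsilon> P\<^sub>S P\<^sub>S\<^sub>i P\<^sub>N)) k\<^sub>2"

end

theory Submission
  imports Defs
begin

text \<open>
  Write \<open>p, t, a\<close> for the lower bounds of \<open>\<pi>, \<tau>, \<alpha>\<close>; the upper bounds are \<open>p + \<epsilon>, t + \<epsilon>, a + \<epsilon>\<close>.
  Clamping shows that the pairs \<open>(g, B)\<close> of a gap \<open>g\<close> and a bound \<open>B\<close> occurring in \<open>U\<^sub>1(k)\<close> are those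
  with \<open>L \<le> g \<le> p\<^sub>k - a\<^sub>k + \<epsilon>\<close>, \<open>B \<ge> c\<close>, \<open>B \<ge> M - g\<close> and \<open>g - B \<le> p\<^sub>k - t\<^sub>k + \<epsilon>\<close>, where
  \<open>L = max\<^sub>i max(0, p\<^sub>i - a\<^sub>i)\<close>, \<open>c = max\<^sub>i max(0, \<bar>t\<^sub>i - a\<^sub>i\<bar> - \<epsilon>)\<close>, \<open>M = max\<^sub>i (p\<^sub>i - t\<^sub>i)\<close>.
  Hence an optimal solution of value \<open>u\<close> with least gap has gap \<open>max L (u + c) ((u + M) / 2)\<close>, a
  monotone function of \<open>u\<close> that does not depend on \<open>k\<close>, so selecting by the gap selects a
  program of largest value. At that largest value the gap is \<open>max 0 (u + c)\<close>. Negating all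
  sequences turns \<open>U\<^sub>2\<close> into \<open>U\<^sub>1\<close> and leaves \<open>c\<close> unchanged, so the gaps of the two families
  compare as their values do, except that both may be cut off at \<open>0\<close>. Since \<open>u + c \<ge> p\<^sub>i - a\<^sub>i\<close> in the
  first family and \<open>u + c \<ge> a\<^sub>i - p\<^sub>i\<close> in the second, the two sums \<open>u + c\<close> are not both negative.
\<close>

section \<open>Construction of points by clamping\<close>

text \<open>The gap prescribes \<open>\<alpha> k\<close>; elsewhere \<alpha> follows
  \<open>t\<close>, capped so as to pass monotonically through that value, and \<tau> follows
  \<alpha>. The order \<open>R\<close> is left open because negating the sequences for the second
  family reverses monotonicity.\<close>

lemma clamp_profile:
  fixes p t a :: "'a \<Rightarrow> real" and \<epsilon> B g :: real
  assumes R: "reflp R" "transp R"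
    and mono: "monotone_on I R (\<le>) p" "monotone_on I R (\<le>) t" "monotone_on I R (\<le>) a"
    and k: "k \<in> I" and \<epsilon>: "0 \<le> \<epsilon>"
    and g: "g \<le> p k - a k + \<epsilon>" "\<And>i. i \<in> I \<Longrightarrow> p i - a i \<le> g"
    and B: "0 \<le> B" "\<And>i. i \<in> I \<Longrightarrow> \<bar>t i - a i\<bar> \<le> B + \<epsilon>" "\<And>i. i \<in> I \<Longrightarrow> p i - t i \<le> g + B"
      "g - B \<le> p k - t k + \<epsilon>"
  obtains \<tau> \<alpha> where "monotone_on I R (\<le>) \<tau>" "monotone_on I R (\<le>) \<alpha>"
    "\<And>i. i \<in> I \<Longrightarrow> t i \<le> \<tau> i \<and> \<tau> i \<le> t i + \<epsilon>" "\<And>i. i \<in> I \<Longrightarrow> a i \<le> \<alpha> i \<and> \<alpha> i \<le> a i + \<epsilon>"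
    "\<And>i. i \<in> I \<Longrightarrow> \<bar>\<tau> i - \<alpha> i\<bar> \<le> B" "\<alpha> k = p k + \<epsilon> - g" "\<And>i. i \<in> I \<Longrightarrow> p i + \<epsilon> - \<alpha> i \<le> g"
proof -
  define y where "y = p k + \<epsilon> - g"
  \<comment> \<open>The cap at \<open>y\<close> covers all indices \<open>R\<close>-below
    \<open>k\<close>, so that \<open>b k \<le> y\<close> and \<open>b\<close> stays
    monotone.\<close>
  define b where "b i = (if R i k then min (t i) y else t i)" for i
  \<comment> \<open>This clamps \<open>b i\<close> to the interval from
    \<open>max (a i) (p i + \<epsilon> - g)\<close> to \<open>a i + \<epsilon>\<close>, nonempty by
    \<open>\<epsilon>\<close> and \<open>g(2)\<close>. At \<open>k\<close> the lower end is
    \<open>y\<close> and \<open>b k \<le> y\<close>, so the value is exactly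
    \<open>y\<close>.\<close>
  define \<alpha> where "\<alpha> i = max (max (a i) (p i + \<epsilon> - g)) (min (a i + \<epsilon>) (b i))" for i
  define \<tau> where "\<tau> i = max (t i) (min (t i + \<epsilon>) (\<alpha> i))" for i
  have le: "p i \<le> p j" "t i \<le> t j" "a i \<le> a j" if "i \<in> I" "j \<in> I" "R i j" for i j
    using mono that by (auto dest: monotone_onD)
  have b_le: "b i \<le> b j" if "i \<in> I" "j \<in> I" "R i j" for i j
    using le(2)[OF that] transpD[OF R(2) that(3), of k] by (auto simp: b_def)
  have \<alpha>_le: "\<alpha> i \<le> \<alpha> j" if "i \<in> I" "j \<in> I" "R i j" for i j
    using le[OF that] b_le[OF that] by (auto simp: \<alpha>_def)
  \<comment> \<open>Below \<open>k\<close> the cap costs at most \<open>B\<close>, since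
    \<open>t i \<le> t k\<close> and \<open>B(4)\<close> says
    \<open>t k - B \<le> y\<close>.\<close>
  have b_ge: "t i - B \<le> b i" if "i \<in> I" for i
    using le(2)[OF that k] B(1,4) by (auto simp: b_def y_def min_def)
  have b_t: "b i \<le> t i" for i
    by (simp add: b_def)
  show thesis
  proof (rule that)
    show "monotone_on I R (\<le>) \<tau>" "monotone_on I R (\<le>) \<alpha>"
      using \<alpha>_le le(2) by (force intro!: monotone_onI simp: \<tau>_def)+
    show "t i \<le> \<tau> i \<and> \<tau> i \<le> t i + \<epsilon>" if "i \<in> I" for i
      using \<epsilon> by (auto simp: \<tau>_def)
    show "a i \<le> \<alpha> i \<and> \<alpha> i \<le> a i + \<epsilon>" if "i \<in> I" for i
      using \<epsilon> g(2)[OF that] by (auto simp: \<alpha>_def)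
    \<comment> \<open>As \<open>\<tau> i\<close> is the point of the interval from
      \<open>t i\<close> to \<open>t i + \<epsilon>\<close> nearest to \<open>\<alpha> i\<close>, it
      suffices that \<open>\<alpha> i\<close> lies within \<open>B\<close> of that interval.\<close>
    show "\<bar>\<tau> i - \<alpha> i\<bar> \<le> B" if "i \<in> I" for i
    proof -
      have "t i - B \<le> \<alpha> i"
        using b_ge[OF that] B(2)[OF that] by (auto simp: \<alpha>_def)
      moreover have "\<alpha> i \<le> t i + \<epsilon> + B"
        using b_t[of i] B(1) B(2,3)[OF that] \<epsilon> by (auto simp: \<alpha>_def)
      ultimately show ?thesis
        using B(1) \<epsilon> by (auto simp: \<tau>_def)
    qed
    show "\<alpha> k = p k + \<epsilon> - g"
      using g(1) reflpD[OF R(1)] by (auto simp: \<alpha>_def b_def y_def)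
    show "p i + \<epsilon> - \<alpha> i \<le> g" if "i \<in> I" for i
      by (auto simp: \<alpha>_def)
  qed
qed

section \<open>Families of programs seen through gap and bound\<close>

text \<open>The sole link to the programs is \<open>attainable\<close>, which says what pairs of gap
  and \<open>B\<close> occur. One argument then serves both families, the second with negated upper
  bounds in the role of lower bounds.\<close>

locale lp_family =
  fixes I :: "nat set" and \<epsilon> :: real and p t a :: "nat \<Rightarrow> real"
    and feasible :: "nat \<Rightarrow> lp_point \<Rightarrow> bool" and gap :: "nat \<Rightarrow> lp_point \<Rightarrow> real"
  assumes finite_I: "finite I" and I_nonempty: "I \<noteq> {}" and eps: "0 \<le> \<epsilon>"
    and attainable: "k \<in> I \<Longrightarrow> (\<exists>x. feasible k x \<and> gap k x = g \<and> fst x = B) \<longleftrightarrow>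
      0 \<le> g \<and> (\<forall>i\<in>I. p i - a i \<le> g) \<and> g \<le> p k - a k + \<epsilon> \<and>
      0 \<le> B \<and> (\<forall>i\<in>I. \<bar>t i - a i\<bar> \<le> B + \<epsilon>) \<and> (\<forall>i\<in>I. p i - t i \<le> g + B) \<and>
      g - B \<le> p k - t k + \<epsilon>"
begin

definition obj :: "nat \<Rightarrow> lp_point \<Rightarrow> real" where
  "obj k x = gap k x - fst x"

definition solvable :: "nat \<Rightarrow> bool" where
  "solvable k \<longleftrightarrow> k \<in> I \<and> (\<exists>x. feasible k x)"

definition solution :: "nat \<Rightarrow> lp_point \<Rightarrow> bool" where
  "solution k x \<longleftrightarrow> is_arg_min (gap k) (is_arg_max (obj k) (feasible k)) x"

definition selected :: "(nat \<Rightarrow> lp_point) \<Rightarrow> nat \<Rightarrow> bool" where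
  "selected s k \<longleftrightarrow>
     is_arg_max (\<lambda>k. obj k (s k)) (is_arg_max (\<lambda>k. gap k (s k)) solvable) k"

text \<open>\<open>offset\<close>, \<open>gap_floor\<close> and \<open>excess\<close> are the
  numbers \<open>c\<close>, \<open>L\<close> and \<open>M\<close> of the overview. The maximum with
  0 in the first two absorbs the constraints \<open>0 \<le> B\<close> and
  \<open>0 \<le> g\<close>.\<close>

definition offset :: real where
  "offset = (MAX i\<in>I. max 0 (\<bar>t i - a i\<bar> - \<epsilon>))"

definition gap_floor :: real where
  "gap_floor = (MAX i\<in>I. max 0 (p i - a i))"

definition excess :: real where
  "excess = (MAX i\<in>I. p i - t i)"

text \<open>At value \<open>u\<close> the bound is \<open>B = g - u\<close>, so
  \<open>B \<ge> offset\<close> and \<open>g + B \<ge> excess\<close> turn into lower bounds on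
  \<open>g\<close>. With \<open>gap_floor\<close> these are all the lower bounds on the gap, and
  none mentions \<open>k\<close>.\<close>

definition least_gap :: "real \<Rightarrow> real" where
  "least_gap u = max gap_floor (max (u + offset) ((u + excess) / 2))"

lemma offset_le_iff: "offset \<le> B \<longleftrightarrow> 0 \<le> B \<and> (\<forall>i\<in>I. \<bar>t i - a i\<bar> \<le> B + \<epsilon>)"
  using finite_I I_nonempty by (auto simp: offset_def diff_le_eq)

lemma gap_floor_le_iff: "gap_floor \<le> g \<longleftrightarrow> 0 \<le> g \<and> (\<forall>i\<in>I. p i - a i \<le> g)"
  using finite_I I_nonempty by (auto simp: gap_floor_def)

lemma excess_le_iff: "excess \<le> u \<longleftrightarrow> (\<forall>i\<in>I. p i - t i \<le> u)"
  using finite_I I_nonempty by (auto simp: excess_def)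

lemma least_gap_le_iff:
  "least_gap u \<le> g \<longleftrightarrow> gap_floor \<le> g \<and> u + offset \<le> g \<and> u + excess \<le> 2 * g"
  by (auto simp: least_gap_def)

lemma least_gap_mono: "u \<le> v \<Longrightarrow> least_gap u \<le> least_gap v"
  unfolding least_gap_def by (intro max.mono) auto

lemma attainable_iff:
  assumes "k \<in> I"
  shows "(\<exists>x. feasible k x \<and> gap k x = g \<and> fst x = B) \<longleftrightarrow>
    gap_floor \<le> g \<and> g \<le> p k - a k + \<epsilon> \<and> offset \<le> B \<and> excess \<le> g + B \<and>
    g - B \<le> p k - t k + \<epsilon>"
  unfolding attainable[OF assms] offset_le_iff gap_floor_le_iff excess_le_iff by blast

text \<open>In the coordinates gap and value, the index \<open>k\<close> enters only through one
  upper bound on the gap and one on the value.\<close>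

lemma feasibleD:
  assumes "k \<in> I" "feasible k x"
  shows "gap_floor \<le> gap k x" "gap k x \<le> p k - a k + \<epsilon>" "offset \<le> gap k x - obj k x"
    "excess \<le> 2 * gap k x - obj k x" "obj k x \<le> p k - t k + \<epsilon>"
proof -
  have "\<exists>y. feasible k y \<and> gap k y = gap k x \<and> fst y = fst x"
    using assms(2) by blast
  then show "gap_floor \<le> gap k x" "gap k x \<le> p k - a k + \<epsilon>" "offset \<le> gap k x - obj k x"
    "excess \<le> 2 * gap k x - obj k x" "obj k x \<le> p k - t k + \<epsilon>"
    unfolding attainable_iff[OF assms(1)] by (simp_all add: obj_def)
qed

lemma feasible_witness:
  assumes "k \<in> I" "gap_floor \<le> g" "g \<le> p k - a k + \<epsilon>" "offset \<le> g - u"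
    "excess \<le> 2 * g - u" "u \<le> p k - t k + \<epsilon>"
  obtains x where "feasible k x" "gap k x = g" "obj k x = u"
proof -
  have "\<exists>x. feasible k x \<and> gap k x = g \<and> fst x = g - u"
    using assms by (subst attainable_iff) auto
  then show thesis
    using that by (auto simp: obj_def)
qed

text \<open>Lowering the gap at fixed value respects both upper bounds, so only the lower bounds
  collected in \<open>least_gap\<close> limit it.\<close>

lemma least_gap_witness:
  assumes "k \<in> I" "feasible k x"
  obtains y where "feasible k y" "gap k y = least_gap (obj k x)" "obj k y = obj k x"
    "least_gap (obj k x) \<le> gap k x"
proof -
  note D = feasibleD[OF assms]
  have le: "least_gap (obj k x) \<le> gap k x"
    using D(1,3,4) by (simp add: least_gap_le_iff)
  show thesis
    by (rule feasible_witness[of k "least_gap (obj k x)" "obj k x"])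
      (use assms(1) D(2,5) le that least_gap_le_iff[of "obj k x" "least_gap (obj k x)"] in auto)
qed

text \<open>Every upper bound on the value is nondecreasing in the gap, so the largest admissible
  gap yields an explicit optimum.\<close>

lemma optimum_exists:
  assumes "solvable k"
  obtains x where "is_arg_max (obj k) (feasible k) x"
proof -
  obtain z where z: "k \<in> I" "feasible k z"
    using assms by (auto simp: solvable_def)
  define g where "g = p k - a k + \<epsilon>"
  \<comment> \<open>The three terms are the conditions \<open>B \<ge> offset\<close>,
    \<open>g + B \<ge> excess\<close> and \<open>g - B \<le> p k - t k + \<epsilon>\<close> solved
    for the value \<open>g - B\<close>.\<close>
  define u where "u = min (min (g - offset) (2 * g - excess)) (p k - t k + \<epsilon>)"
  obtain x where x: "feasible k x" "obj k x = u"
    by (rule feasible_witness[of k g u]) (use z feasibleD[OF z] in \<open>auto simp: u_def g_def\<close>)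
  have "obj k y \<le> u" if "feasible k y" for y
    using feasibleD[OF z(1) that] by (auto simp: u_def g_def)
  then have "is_arg_max (obj k) (feasible k) x"
    using x by (auto simp: is_arg_max_linorder)
  then show thesis ..
qed

text \<open>Breaking ties by the least gap makes the gap a function of the optimal value alone, the
  same function for every \<open>k\<close>.\<close>

lemma gap_solution:
  assumes "k \<in> I" "solution k x"
  shows "gap k x = least_gap (obj k x)"
proof -
  have x: "feasible k x" "\<And>y. feasible k y \<Longrightarrow> obj k y \<le> obj k x"
    "\<And>y. is_arg_max (obj k) (feasible k) y \<Longrightarrow> gap k x \<le> gap k y"
    using assms(2) by (auto simp: solution_def is_arg_min_linorder is_arg_max_linorder)
  obtain y where y: "feasible k y" "gap k y = least_gap (obj k x)" "obj k y = obj k x"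
    "least_gap (obj k x) \<le> gap k x"
    using least_gap_witness[OF assms(1) x(1)] .
  have "is_arg_max (obj k) (feasible k) y"
    using x(2) y(1,3) by (simp add: is_arg_max_linorder)
  then show ?thesis
    using x(3) y(2,4) by fastforce
qed

lemma solution_exists:
  assumes "solvable k"
  shows "\<exists>x. solution k x"
proof -
  have k: "k \<in> I"
    using assms by (simp add: solvable_def)
  obtain x where x: "is_arg_max (obj k) (feasible k) x"
    using optimum_exists[OF assms] .
  then have fx: "feasible k x" and max: "\<And>y. feasible k y \<Longrightarrow> obj k y \<le> obj k x"
    by (auto simp: is_arg_max_linorder)
  obtain y where y: "feasible k y" "gap k y = least_gap (obj k x)" "obj k y = obj k x"
    using least_gap_witness[OF k fx] .
  have "gap k y \<le> gap k z" if z: "is_arg_max (obj k) (feasible k) z" for z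
  proof -
    have "feasible k z" "obj k z = obj k x"
      using z max[of z] fx unfolding is_arg_max_linorder by (blast intro: antisym)+
    then show ?thesis
      using least_gap_witness[OF k, of z] y(2) by metis
  qed
  then have "solution k y"
    using y max by (auto simp: solution_def is_arg_min_linorder is_arg_max_linorder)
  then show ?thesis ..
qed

section \<open>Optima over a whole family\<close>

definition best :: "nat \<Rightarrow> lp_point \<Rightarrow> bool" where
  "best k x \<longleftrightarrow> k \<in> I \<and> feasible k x \<and> (\<forall>j\<in>I. \<forall>y. feasible j y \<longrightarrow> obj j y \<le> obj k x)"

lemma bestD:
  assumes "best k x"
  shows "k \<in> I" "feasible k x" "j \<in> I \<Longrightarrow> feasible j y \<Longrightarrow> obj j y \<le> obj k x"
  using assms unfolding best_def by blast+

lemma best_exists: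
  assumes "solvable j"
  shows "\<exists>k x. best k x"
proof -
  define S where "S = {k. solvable k}"
  have S: "finite S" "S \<noteq> {}"
    using finite_I assms by (auto simp: S_def solvable_def)
  define s where "s k = (SOME x. is_arg_max (obj k) (feasible k) x)" for k
  have s: "is_arg_max (obj k) (feasible k) (s k)" if "solvable k" for k
    unfolding s_def by (rule optimum_exists[OF that], rule someI)
  have "Max ((\<lambda>k. obj k (s k)) ` S) \<in> (\<lambda>k. obj k (s k)) ` S"
    using S by simp
  then obtain k where k: "k \<in> S" "obj k (s k) = Max ((\<lambda>k. obj k (s k)) ` S)"
    by auto
  have "obj i y \<le> obj k (s k)" if "i \<in> I" "feasible i y" for i y
  proof -
    have "i \<in> S"
      using that unfolding S_def solvable_def by blast
    then have "obj i y \<le> obj i (s i)"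
      using s that unfolding S_def is_arg_max_linorder by blast
    also have "\<dots> \<le> obj k (s k)"
      using S \<open>i \<in> S\<close> by (simp add: k(2))
    finally show ?thesis .
  qed
  moreover have "k \<in> I" "feasible k (s k)"
    using k(1) s by (auto simp: S_def solvable_def is_arg_max_linorder)
  ultimately show ?thesis
    unfolding best_def by blast
qed

text \<open>\<open>least_gap\<close> is monotone, though not strictly: a program of larger value has
  at least as large a gap, and if the gaps tie, the second convention prefers the larger
  value.\<close>

lemma best_selected:
  assumes s: "\<And>k. solvable k \<Longrightarrow> solution k (s k)" and sel: "selected s k"
  shows "best k (s k)"
proof -
  have k: "k \<in> I" "solvable k"
    using sel by (auto simp: selected_def is_arg_max_linorder solvable_def)
  have gap_s: "gap j (s j) = least_gap (obj j (s j))" if "solvable j" for j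
    using gap_solution s that by (simp add: solvable_def)
  have max: "obj j (s j) \<le> obj k (s k)" if j: "solvable j" for j
  proof (rule ccontr)
    assume less: "\<not> ?thesis"
    then have "gap k (s k) \<le> gap j (s j)"
      by (simp add: gap_s j k least_gap_mono)
    then have "is_arg_max (\<lambda>k. gap k (s k)) solvable j"
      using sel j by (auto simp: selected_def is_arg_max_linorder intro: order_trans)
    then show False
      using sel less by (auto simp: selected_def is_arg_max_linorder)
  qed
  have "obj j y \<le> obj k (s k)" if "j \<in> I" "feasible j y" for j y
  proof -
    have j: "solvable j"
      using that unfolding solvable_def by blast
    then have "obj j y \<le> obj j (s j)"
      using s[OF j] that unfolding solution_def is_arg_min_def is_arg_max_linorder by blast
    then show ?thesis
      using max[OF j] by simp
  qed
  moreover have "feasible k (s k)"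
    using s[OF k(2)] by (auto simp: solution_def is_arg_min_def is_arg_max_def)
  ultimately show ?thesis
    using k by (auto simp: best_def)
qed

text \<open>Let \<open>m\<close> be the maximum of \<open>p - a\<close>. At an index attaining it
  the gap \<open>m + \<epsilon>\<close> can be had with \<open>B\<close> at most
  \<open>offset + \<epsilon>\<close>, hence with value at least \<open>m - offset\<close>.\<close>

lemma best_value_ge:
  assumes "best k x" "i \<in> I"
  shows "p i - a i \<le> obj k x + offset"
proof -
  define m where "m = (MAX i\<in>I. p i - a i)"
  have le_m: "p j - a j \<le> m" if "j \<in> I" for j
    using finite_I that by (simp add: m_def)
  have "m \<in> (\<lambda>i. p i - a i) ` I"
    unfolding m_def using finite_I I_nonempty by simp
  then obtain j where j: "j \<in> I" "p j - a j = m"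
    by auto
  \<comment> \<open>The least bound compatible with gap \<open>m + \<epsilon>\<close> at
    \<open>j\<close>; the second term comes from
    \<open>g - B \<le> p j - t j + \<epsilon>\<close>.\<close>
  define B where "B = max offset (t j - a j)"
  have off: "\<bar>t i - a i\<bar> \<le> offset + \<epsilon>" if "i \<in> I" for i
    using offset_le_iff[of offset] that by simp
  have k: "k \<in> I" "feasible k x"
    using bestD[OF assms(1)] by auto
  obtain y where y: "feasible j y" "obj j y = m + \<epsilon> - B"
  proof (rule feasible_witness[of j "m + \<epsilon>" "m + \<epsilon> - B"])
    \<comment> \<open>A feasible point in any program of the family forces
      \<open>m + \<epsilon>\<close> to be nonnegative.\<close>
    have "0 \<le> gap k x"
      using feasibleD(1)[OF k] by (simp add: gap_floor_le_iff)
    then have "0 \<le> m + \<epsilon>"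
      using feasibleD(2)[OF k] le_m[OF k(1)] by simp
    then show "gap_floor \<le> m + \<epsilon>"
      using le_m eps by (force simp: gap_floor_le_iff)
    show "excess \<le> 2 * (m + \<epsilon>) - (m + \<epsilon> - B)"
      unfolding excess_le_iff
    proof
      fix i assume "i \<in> I"
      \<comment> \<open>Split \<open>p i - t i\<close> as
        \<open>(p i - a i) + (a i - t i)\<close>.\<close>
      show "p i - t i \<le> 2 * (m + \<epsilon>) - (m + \<epsilon> - B)"
        using le_m[OF \<open>i \<in> I\<close>] off[OF \<open>i \<in> I\<close>] by (auto simp: B_def)
    qed
  qed (use j in \<open>auto simp: B_def\<close>)
  have "B \<le> offset + \<epsilon>"
    using off[OF j(1)] eps by (auto simp: B_def)
  moreover have "obj j y \<le> obj k x"
    using bestD(3)[OF assms(1) j(1) y(1)] .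
  ultimately show ?thesis
    using le_m[OF assms(2)] y(2) by simp
qed

text \<open>At the optimum of the family, the terms of \<open>least_gap\<close> with
  \<open>gap_floor\<close> and \<open>excess\<close> are dominated by the term with
  \<open>offset\<close>, up to the cut-off at 0.\<close>

lemma least_gap_best:
  assumes "best k x"
  shows "least_gap (obj k x) = max 0 (obj k x + offset)"
proof -
  have floor: "gap_floor \<le> max 0 (obj k x + offset)"
    using best_value_ge[OF assms] by (force simp: gap_floor_le_iff)
  have floor0: "0 \<le> gap_floor"
    using gap_floor_le_iff[of gap_floor] by simp
  have off0: "0 \<le> offset"
    using offset_le_iff[of offset] by simp
  have "(obj k x + excess) / 2 \<le> max 0 (obj k x + offset)"
  proof (cases "gap_floor \<le> excess - offset")
    \<comment> \<open>At an index attaining \<open>excess\<close>, the point with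
      \<open>B = offset\<close> and gap \<open>excess - offset\<close> is feasible; optimality gives
      \<open>excess \<le> obj k x + 2 * offset\<close>.\<close>
    case True
    have "excess \<in> (\<lambda>i. p i - t i) ` I"
      unfolding excess_def using finite_I I_nonempty by simp
    then obtain j where j: "j \<in> I" "p j - t j = excess"
      by auto
    have j_off: "\<bar>t j - a j\<bar> \<le> offset + \<epsilon>"
      using offset_le_iff[of offset] j(1) by simp
    obtain y where "feasible j y" "obj j y = excess - 2 * offset"
      by (rule feasible_witness[of j "excess - offset" "excess - 2 * offset"])
        (use j j_off True off0 eps in auto)
    then have "excess - 2 * offset \<le> obj k x"
      using bestD(3)[OF assms j(1)] by metis
    then show ?thesis
      by (simp add: le_max_iff_disj)
  next
    \<comment> \<open>Now the left-hand side is below the mean of \<open>obj k x + offset\<close>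
      and \<open>gap_floor\<close>, neither of which exceeds the right-hand side.\<close>
    case False
    then show ?thesis
      using floor by (auto simp: max_def split: if_splits)
  qed
  then have "least_gap (obj k x) \<le> max 0 (obj k x + offset)"
    using floor by (simp add: least_gap_le_iff)
  moreover have "max 0 (obj k x + offset) \<le> least_gap (obj k x)"
    using floor0 least_gap_le_iff[of "obj k x" "least_gap (obj k x)"] by simp
  ultimately show ?thesis
    by (rule antisym)
qed

text \<open>In this form the gap depends on the family only through its optimal value and
  \<open>offset\<close>; since both families share \<open>offset\<close>, their gaps become
  comparable.\<close>

lemma gap_selected:
  assumes s: "\<And>k. solvable k \<Longrightarrow> solution k (s k)" and sel: "selected s k"
  shows "gap k (s k) = max 0 (obj k (s k) + offset)"
proof -
  have "best k (s k)"
    using best_selected[OF assms] .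
  moreover have "k \<in> I" "solution k (s k)"
    using sel s by (auto simp: selected_def is_arg_max_def solvable_def)
  ultimately show ?thesis
    by (simp add: gap_solution least_gap_best)
qed

end

section \<open>Cumulative bounds and the Kolmogorov-Smirnov distance\<close>

lemma mono_on_atLeastAtMost_iff_Suc:
  fixes f :: "nat \<Rightarrow> real"
  shows "(\<forall>i\<in>{1..C-2}. f i \<le> f (i + 1)) \<longleftrightarrow> mono_on {1..C-1} f"
proof
  assume step: "\<forall>i\<in>{1..C-2}. f i \<le> f (i + 1)"
  have "f i \<le> f j" if "i \<le> j" "1 \<le> i" "j \<le> C - 1" for i j
    using that
  proof (induction j rule: dec_induct)
    case (step n)
    moreover have "f n \<le> f (n + 1)"
      using step.hyps step.prems \<open>\<forall>i\<in>{1..C-2}. f i \<le> f (i + 1)\<close> by auto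
    ultimately show ?case
      by simp
  qed simp
  then show "mono_on {1..C-1} f"
    by (auto intro: monotone_onI)
next
  assume f: "mono_on {1..C-1} f"
  have "f i \<le> f (i + 1)" if "i \<in> {1..C-2}" for i
    using monotone_onD[OF f, of i "i + 1"] that by auto
  then show "\<forall>i\<in>{1..C-2}. f i \<le> f (i + 1)"
    by blast
qed

lemma mono_cum_lower: "\<epsilon> \<le> 1 \<Longrightarrow> mono (cum_lower \<epsilon> P)"
  unfolding cum_lower_def cum_prob_def
  by (intro monoI mult_left_mono measure_pmf.finite_measure_mono) auto

lemma cum_lower_nonneg: "\<epsilon> \<le> 1 \<Longrightarrow> 0 \<le> cum_lower \<epsilon> P i"
  by (simp add: cum_lower_def cum_prob_def)

lemma cum_upper_eq: "cum_upper \<epsilon> P i = cum_lower \<epsilon> P i + \<epsilon>"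
  by (simp add: cum_lower_def cum_upper_def)

lemma cum_upper_le_1:
  assumes "\<epsilon> \<le> 1"
  shows "cum_upper \<epsilon> P i \<le> 1"
proof -
  have "(1 - \<epsilon>) * cum_prob P i \<le> 1 - \<epsilon>"
    using assms mult_left_le[of "cum_prob P i" "1 - \<epsilon>"] by (simp add: cum_prob_def)
  then show ?thesis
    by (simp add: cum_upper_def)
qed

lemma common_constraints_iff:
  "common_constraints C \<epsilon> P Q (B, \<tau>, \<alpha>) \<longleftrightarrow>
     within_bounds C \<epsilon> P \<tau> \<and> within_bounds C \<epsilon> Q \<alpha> \<and> (\<forall>i\<in>{1..C-1}. \<bar>\<tau> i - \<alpha> i\<bar> \<le> B) \<and>
     mono_on {1..C-1} \<tau> \<and> mono_on {1..C-1} \<alpha>"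
  unfolding common_constraints_def prod.case abs_le_iff mono_on_atLeastAtMost_iff_Suc[symmetric]
  by auto

lemma U1_feasible_iff:
  "U1_feasible C \<epsilon> P\<^sub>S P\<^sub>S\<^sub>i P\<^sub>N k (B, \<tau>, \<alpha>) \<longleftrightarrow>
     common_constraints C \<epsilon> P\<^sub>S\<^sub>i P\<^sub>N (B, \<tau>, \<alpha>) \<and> \<alpha> k \<le> cum_upper \<epsilon> P\<^sub>S k \<and>
     (\<forall>i\<in>{1..C-1}. cum_upper \<epsilon> P\<^sub>S i - \<alpha> i \<le> cum_upper \<epsilon> P\<^sub>S k - \<alpha> k)"
  by (auto simp: U1_feasible_def)

lemma U2_feasible_iff:
  "U2_feasible C \<epsilon> P\<^sub>S P\<^sub>S\<^sub>i P\<^sub>N k (B, \<tau>, \<alpha>) \<longleftrightarrow>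
     common_constraints C \<epsilon> P\<^sub>S\<^sub>i P\<^sub>N (B, \<tau>, \<alpha>) \<and> cum_lower \<epsilon> P\<^sub>S k \<le> \<alpha> k \<and>
     (\<forall>i\<in>{1..C-1}. \<alpha> i - cum_lower \<epsilon> P\<^sub>S i \<le> \<alpha> k - cum_lower \<epsilon> P\<^sub>S k)"
  by (auto simp: U2_feasible_def)

lemma ks_dist_le_iff:
  assumes "C \<ge> 2"
  shows "ks_dist C F G \<le> d \<longleftrightarrow> (\<forall>i\<in>{1..C-1}. \<bar>F i - G i\<bar> \<le> d)"
  using assms by (auto simp: ks_dist_def)

lemma ks_dist_ge: "i \<in> {1..C-1} \<Longrightarrow> \<bar>F i - G i\<bar> \<le> ks_dist C F G"
  by (auto simp: ks_dist_def intro!: Max_ge)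

lemma ks_dist_attained:
  assumes "C \<ge> 2"
  obtains k where "k \<in> {1..C-1}" "ks_dist C F G = \<bar>F k - G k\<bar>"
proof -
  have "ks_dist C F G \<in> (\<lambda>i. \<bar>F i - G i\<bar>) ` {1..C-1}"
    unfolding ks_dist_def using assms by (intro Max_in) auto
  then show thesis
    using that by auto
qed

text \<open>The programs speak only of indices below \<open>C\<close>. Setting the last value to 1
  keeps monotonicity because no upper bound exceeds 1.\<close>

lemma cumulative_distribution_extend:
  assumes "C \<ge> 2" "\<epsilon> \<le> 1" "within_bounds C \<epsilon> P F" "mono_on {1..C-1} F"
  shows "cumulative_distribution C (F(C := 1))" "within_bounds C \<epsilon> P (F(C := 1))"
proof -
  have F: "0 \<le> F i \<and> F i \<le> 1" if "i \<in> {1..C-1}" for i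
  proof -
    have "cum_lower \<epsilon> P i \<le> F i" "F i \<le> cum_upper \<epsilon> P i"
      using assms(3) that unfolding within_bounds_def by blast+
    then show ?thesis
      using cum_lower_nonneg[OF assms(2), of P i] cum_upper_le_1[OF assms(2), of P i] by linarith
  qed
  have "mono_on {1..C} (F(C := 1))"
  proof (rule monotone_onI)
    fix i j assume ij: "i \<in> {1..C}" "j \<in> {1..C}" "i \<le> j"
    show "(F(C := 1)) i \<le> (F(C := 1)) j"
    proof (cases "i = C \<or> j = C")
      case True
      then show ?thesis
        using F[of i] ij by force
    next
      case False
      then have "i \<in> {1..C-1}" "j \<in> {1..C-1}"
        using ij by auto
      then have "F i \<le> F j"
        using monotone_onD[OF assms(4)] ij(3) by blast
      then show ?thesis
        using False by simp
    qed
  qed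
  then show "cumulative_distribution C (F(C := 1))"
    using F[of 1] assms(1) by (auto simp: cumulative_distribution_def)
  have "(F(C := 1)) i = F i" if "i \<in> {1..C-1}" for i
    using that assms(1) by auto
  then show "within_bounds C \<epsilon> P (F(C := 1))"
    using assms(3) by (simp add: within_bounds_def)
qed

lemma cumulative_distribution_mono_on:
  "cumulative_distribution C F \<Longrightarrow> mono_on {1..C-1} F"
  unfolding cumulative_distribution_def by (rule monotone_on_subset[of "{1..C}"]) auto

section \<open>Comparison of the original problem with the programs\<close>

text \<open>The completion at \<open>C\<close> does not enter the distances. \<open>B\<close> bounds
  the distance of \<tau> and \<alpha> from above, and the single index \<open>k\<close> bounds that
  of \<pi> and \<alpha> from below.\<close>

lemma U_feasible_ge:
  assumes C: "C \<ge> 2" and \<epsilon>: "\<epsilon> \<le> 1" and k: "k \<in> {1..C-1}"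
    and con: "common_constraints C \<epsilon> P\<^sub>S\<^sub>i P\<^sub>N (B, \<tau>, \<alpha>)"
    and \<pi>: "within_bounds C \<epsilon> P\<^sub>S \<pi>" "mono_on {1..C-1} \<pi>"
  shows "\<exists>y. U_feasible C \<epsilon> P\<^sub>S P\<^sub>S\<^sub>i P\<^sub>N y \<and> \<bar>\<pi> k - \<alpha> k\<bar> - B \<le> ks_diff C y"
proof -
  have less_C: "i \<noteq> C" if "i \<in> {1..C-1}" for i
    using that C by auto
  define y where "y = (\<pi>(C := 1), \<tau>(C := 1), \<alpha>(C := 1))"
  have "U_feasible C \<epsilon> P\<^sub>S P\<^sub>S\<^sub>i P\<^sub>N y"
    using con \<pi> unfolding U_feasible_def y_def common_constraints_iff prod.case
    by (blast intro: cumulative_distribution_extend[OF C \<epsilon>])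
  moreover have "\<bar>\<pi> k - \<alpha> k\<bar> \<le> ks_dist C (\<pi>(C := 1)) (\<alpha>(C := 1))"
    using ks_dist_ge[OF k, of "\<pi>(C := 1)" "\<alpha>(C := 1)"] less_C[OF k] by simp
  moreover have "ks_dist C (\<tau>(C := 1)) (\<alpha>(C := 1)) \<le> B"
    unfolding ks_dist_le_iff[OF C]
    using con less_C unfolding common_constraints_iff by simp
  ultimately show ?thesis
    by (intro exI[of _ y]) (simp add: ks_diff_def y_def)
qed

text \<open>At the index where \<pi> and \<alpha> differ most, pushing \<pi> to its upper or lower
  bound, according to the sign, can only enlarge the difference. Moving on to the index
  \<open>k\<close> of largest gap then meets the constraints added to the \<open>k\<close>-th
  program.\<close>

lemma U_feasible_le:
  assumes C: "C \<ge> 2" and y: "U_feasible C \<epsilon> P\<^sub>S P\<^sub>S\<^sub>i P\<^sub>N y"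
  shows "(\<exists>k\<in>{1..C-1}. \<exists>x. U1_feasible C \<epsilon> P\<^sub>S P\<^sub>S\<^sub>i P\<^sub>N k x \<and> ks_diff C y \<le> U1_obj \<epsilon> P\<^sub>S k x) \<or>
    (\<exists>k\<in>{1..C-1}. \<exists>x. U2_feasible C \<epsilon> P\<^sub>S P\<^sub>S\<^sub>i P\<^sub>N k x \<and> ks_diff C y \<le> U2_obj \<epsilon> P\<^sub>S k x)"
proof -
  obtain \<pi> \<tau> \<alpha> where y_eq: "y = (\<pi>, \<tau>, \<alpha>)"
    by (cases y)
  define B where "B = ks_dist C \<tau> \<alpha>"
  have con: "common_constraints C \<epsilon> P\<^sub>S\<^sub>i P\<^sub>N (B, \<tau>, \<alpha>)" and \<pi>: "within_bounds C \<epsilon> P\<^sub>S \<pi>"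
    using y cumulative_distribution_mono_on ks_dist_ge
    by (auto simp: U_feasible_def y_eq common_constraints_iff B_def)
  have ne: "finite {1..C-1}" "{1..C-1} \<noteq> {}"
    using C by auto
  obtain j where j: "j \<in> {1..C-1}" "ks_dist C \<pi> \<alpha> = \<bar>\<pi> j - \<alpha> j\<bar>"
    using ks_dist_attained[OF C] .
  have \<pi>j: "cum_lower \<epsilon> P\<^sub>S j \<le> \<pi> j" "\<pi> j \<le> cum_upper \<epsilon> P\<^sub>S j"
    using \<pi> j(1) by (auto simp: within_bounds_def)
  show ?thesis
  proof (cases "\<alpha> j \<le> \<pi> j")
    case True
    obtain k where k: "k \<in> {1..C-1}" "\<forall>i\<in>{1..C-1}. cum_upper \<epsilon> P\<^sub>S i - \<alpha> i \<le> cum_upper \<epsilon> P\<^sub>S k - \<alpha> k"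
      using obtains_MAX[OF ne, of "\<lambda>i. cum_upper \<epsilon> P\<^sub>S i - \<alpha> i"] ne
      by (metis (no_types, lifting) Max_ge finite_imageI imageI)
    have "\<pi> j - \<alpha> j \<le> cum_upper \<epsilon> P\<^sub>S k - \<alpha> k"
      using k(2) j(1) \<pi>j(2) by fastforce
    then have "U1_feasible C \<epsilon> P\<^sub>S P\<^sub>S\<^sub>i P\<^sub>N k (B, \<tau>, \<alpha>) \<and> ks_diff C y \<le> U1_obj \<epsilon> P\<^sub>S k (B, \<tau>, \<alpha>)"
      using con k(2) True j(2) by (auto simp: U1_feasible_iff U1_obj_def ks_diff_def y_eq B_def)
    then show ?thesis
      using k(1) by blast
  next
    case False
    obtain k where k: "k \<in> {1..C-1}" "\<forall>i\<in>{1..C-1}. \<alpha> i - cum_lower \<epsilon> P\<^sub>S i \<le> \<alpha> k - cum_lower \<epsilon> P\<^sub>S k"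
      using obtains_MAX[OF ne, of "\<lambda>i. \<alpha> i - cum_lower \<epsilon> P\<^sub>S i"] ne
      by (metis (no_types, lifting) Max_ge finite_imageI imageI)
    have "\<alpha> j - \<pi> j \<le> \<alpha> k - cum_lower \<epsilon> P\<^sub>S k"
      using k(2) j(1) \<pi>j(1) by fastforce
    then have "U2_feasible C \<epsilon> P\<^sub>S P\<^sub>S\<^sub>i P\<^sub>N k (B, \<tau>, \<alpha>) \<and> ks_diff C y \<le> U2_obj \<epsilon> P\<^sub>S k (B, \<tau>, \<alpha>)"
      using con k(2) False j(2) by (auto simp: U2_feasible_iff U2_obj_def ks_diff_def y_eq B_def)
    then show ?thesis
      using k(1) by blast
  qed
qed

section \<open>The two families as instances\<close>

text \<open>Necessity follows by combining the interval bounds, sufficiency from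
  \<open>clamp_profile\<close> with the usual order.\<close>

lemma U1_lp_family:
  assumes C: "C \<ge> 2" and \<epsilon>: "0 \<le> \<epsilon>" "\<epsilon> \<le> 1"
  shows "lp_family {1..C-1} \<epsilon> (cum_lower \<epsilon> P\<^sub>S) (cum_lower \<epsilon> P\<^sub>S\<^sub>i) (cum_lower \<epsilon> P\<^sub>N)
    (U1_feasible C \<epsilon> P\<^sub>S P\<^sub>S\<^sub>i P\<^sub>N) (U1_gap \<epsilon> P\<^sub>S)"
proof
  fix k g B
  let ?p = "cum_lower \<epsilon> P\<^sub>S" and ?t = "cum_lower \<epsilon> P\<^sub>S\<^sub>i" and ?a = "cum_lower \<epsilon> P\<^sub>N"
  assume k: "k \<in> {1..C-1}"
  show "(\<exists>x. U1_feasible C \<epsilon> P\<^sub>S P\<^sub>S\<^sub>i P\<^sub>N k x \<and> U1_gap \<epsilon> P\<^sub>S k x = g \<and> fst x = B) \<longleftrightarrow>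
      0 \<le> g \<and> (\<forall>i\<in>{1..C-1}. ?p i - ?a i \<le> g) \<and> g \<le> ?p k - ?a k + \<epsilon> \<and>
      0 \<le> B \<and> (\<forall>i\<in>{1..C-1}. \<bar>?t i - ?a i\<bar> \<le> B + \<epsilon>) \<and> (\<forall>i\<in>{1..C-1}. ?p i - ?t i \<le> g + B) \<and>
      g - B \<le> ?p k - ?t k + \<epsilon>" (is "?L \<longleftrightarrow> ?R")
  proof
    assume ?L
    then obtain \<tau> \<alpha> where f: "U1_feasible C \<epsilon> P\<^sub>S P\<^sub>S\<^sub>i P\<^sub>N k (B, \<tau>, \<alpha>)" "g = ?p k + \<epsilon> - \<alpha> k"
      by (auto simp: U1_gap_def cum_upper_eq)
    have b: "?t i \<le> \<tau> i" "\<tau> i \<le> ?t i + \<epsilon>" "?a i \<le> \<alpha> i" "\<alpha> i \<le> ?a i + \<epsilon>" "\<bar>\<tau> i - \<alpha> i\<bar> \<le> B"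
      "?p i + \<epsilon> - \<alpha> i \<le> g" if "i \<in> {1..C-1}" for i
      using f that
      by (auto simp: U1_feasible_iff common_constraints_iff within_bounds_def cum_upper_eq)
    have "0 \<le> g"
      using f by (simp add: U1_feasible_iff cum_upper_eq)
    moreover have "?p i - ?a i \<le> g \<and> \<bar>?t i - ?a i\<bar> \<le> B + \<epsilon> \<and> ?p i - ?t i \<le> g + B"
      if "i \<in> {1..C-1}" for i
      using b[OF that] by linarith
    moreover have "g \<le> ?p k - ?a k + \<epsilon> \<and> 0 \<le> B \<and> g - B \<le> ?p k - ?t k + \<epsilon>"
      using b[OF k] f(2) by linarith
    ultimately show ?R
      by blast
  next
    assume r: ?R
    obtain \<tau> \<alpha> where *: "mono_on {1..C-1} \<tau>" "mono_on {1..C-1} \<alpha>"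
      "\<And>i. i \<in> {1..C-1} \<Longrightarrow> ?t i \<le> \<tau> i \<and> \<tau> i \<le> ?t i + \<epsilon>"
      "\<And>i. i \<in> {1..C-1} \<Longrightarrow> ?a i \<le> \<alpha> i \<and> \<alpha> i \<le> ?a i + \<epsilon>"
      "\<And>i. i \<in> {1..C-1} \<Longrightarrow> \<bar>\<tau> i - \<alpha> i\<bar> \<le> B" "\<alpha> k = ?p k + \<epsilon> - g"
      "\<And>i. i \<in> {1..C-1} \<Longrightarrow> ?p i + \<epsilon> - \<alpha> i \<le> g"
    proof (rule clamp_profile[of "(\<le>)" "{1..C-1}" ?p ?t ?a k \<epsilon> g B])
      show "mono_on {1..C-1} ?p" "mono_on {1..C-1} ?t" "mono_on {1..C-1} ?a"
        using mono_cum_lower[OF \<epsilon>(2)] by (auto intro: monotone_on_subset)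
    qed (use k r \<epsilon> in auto)
    then have "U1_feasible C \<epsilon> P\<^sub>S P\<^sub>S\<^sub>i P\<^sub>N k (B, \<tau>, \<alpha>)"
      using r by (simp add: U1_feasible_iff common_constraints_iff within_bounds_def cum_upper_eq)
    then show ?L
      using *(6) by (intro exI[of _ "(B, \<tau>, \<alpha>)"]) (simp add: U1_gap_def cum_upper_eq)
  qed
qed (use C \<epsilon> in auto)

text \<open>Negation swaps upper and lower bounds, so negated upper bounds act as lower bounds.
  \<open>B\<close> is unchanged, while increasing sequences become decreasing, hence
  \<open>clamp_profile\<close> with the reversed order.\<close>

lemma U2_lp_family:
  assumes C: "C \<ge> 2" and \<epsilon>: "0 \<le> \<epsilon>" "\<epsilon> \<le> 1"
  shows "lp_family {1..C-1} \<epsilon> (\<lambda>i. - cum_upper \<epsilon> P\<^sub>S i) (\<lambda>i. - cum_upper \<epsilon> P\<^sub>S\<^sub>i i)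
    (\<lambda>i. - cum_upper \<epsilon> P\<^sub>N i) (U2_feasible C \<epsilon> P\<^sub>S P\<^sub>S\<^sub>i P\<^sub>N) (U2_gap \<epsilon> P\<^sub>S)"
proof
  fix k g B
  let ?p = "\<lambda>i. - cum_upper \<epsilon> P\<^sub>S i" and ?t = "\<lambda>i. - cum_upper \<epsilon> P\<^sub>S\<^sub>i i"
    and ?a = "\<lambda>i. - cum_upper \<epsilon> P\<^sub>N i"
  assume k: "k \<in> {1..C-1}"
  show "(\<exists>x. U2_feasible C \<epsilon> P\<^sub>S P\<^sub>S\<^sub>i P\<^sub>N k x \<and> U2_gap \<epsilon> P\<^sub>S k x = g \<and> fst x = B) \<longleftrightarrow>
      0 \<le> g \<and> (\<forall>i\<in>{1..C-1}. ?p i - ?a i \<le> g) \<and> g \<le> ?p k - ?a k + \<epsilon> \<and>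
      0 \<le> B \<and> (\<forall>i\<in>{1..C-1}. \<bar>?t i - ?a i\<bar> \<le> B + \<epsilon>) \<and> (\<forall>i\<in>{1..C-1}. ?p i - ?t i \<le> g + B) \<and>
      g - B \<le> ?p k - ?t k + \<epsilon>" (is "?L \<longleftrightarrow> ?R")
  proof
    assume ?L
    then obtain \<tau> \<alpha> where f: "U2_feasible C \<epsilon> P\<^sub>S P\<^sub>S\<^sub>i P\<^sub>N k (B, \<tau>, \<alpha>)" "g = \<alpha> k + ?p k + \<epsilon>"
      by (auto simp: U2_gap_def cum_upper_eq)
    have b: "?t i \<le> - \<tau> i" "- \<tau> i \<le> ?t i + \<epsilon>" "?a i \<le> - \<alpha> i" "- \<alpha> i \<le> ?a i + \<epsilon>"
      "\<bar>\<tau> i - \<alpha> i\<bar> \<le> B" "?p i + \<epsilon> + \<alpha> i \<le> g" if "i \<in> {1..C-1}" for i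
    proof -
      have "cum_lower \<epsilon> P\<^sub>S\<^sub>i i \<le> \<tau> i \<and> \<tau> i \<le> cum_upper \<epsilon> P\<^sub>S\<^sub>i i \<and> cum_lower \<epsilon> P\<^sub>N i \<le> \<alpha> i \<and>
        \<alpha> i \<le> cum_upper \<epsilon> P\<^sub>N i \<and> \<bar>\<tau> i - \<alpha> i\<bar> \<le> B \<and> \<alpha> i - cum_lower \<epsilon> P\<^sub>S i \<le> g"
        using f that
        by (auto simp: U2_feasible_iff common_constraints_iff within_bounds_def cum_upper_eq)
      then show "?t i \<le> - \<tau> i" "- \<tau> i \<le> ?t i + \<epsilon>" "?a i \<le> - \<alpha> i" "- \<alpha> i \<le> ?a i + \<epsilon>"
        "\<bar>\<tau> i - \<alpha> i\<bar> \<le> B" "?p i + \<epsilon> + \<alpha> i \<le> g"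
        unfolding cum_upper_eq by linarith+
    qed
    have "0 \<le> g"
      using f by (simp add: U2_feasible_iff cum_upper_eq)
    moreover have "?p i - ?a i \<le> g \<and> \<bar>?t i - ?a i\<bar> \<le> B + \<epsilon> \<and> ?p i - ?t i \<le> g + B"
      if "i \<in> {1..C-1}" for i
      using b[OF that] by linarith
    moreover have "g \<le> ?p k - ?a k + \<epsilon> \<and> 0 \<le> B \<and> g - B \<le> ?p k - ?t k + \<epsilon>"
      using b[OF k] f(2) by linarith
    ultimately show ?R
      by blast
  next
    assume r: ?R
    obtain \<tau> \<alpha> where *: "monotone_on {1..C-1} (\<ge>) (\<le>) \<tau>" "monotone_on {1..C-1} (\<ge>) (\<le>) \<alpha>"
      "\<And>i. i \<in> {1..C-1} \<Longrightarrow> ?t i \<le> \<tau> i \<and> \<tau> i \<le> ?t i + \<epsilon>"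
      "\<And>i. i \<in> {1..C-1} \<Longrightarrow> ?a i \<le> \<alpha> i \<and> \<alpha> i \<le> ?a i + \<epsilon>"
      "\<And>i. i \<in> {1..C-1} \<Longrightarrow> \<bar>\<tau> i - \<alpha> i\<bar> \<le> B" "\<alpha> k = ?p k + \<epsilon> - g"
      "\<And>i. i \<in> {1..C-1} \<Longrightarrow> ?p i + \<epsilon> - \<alpha> i \<le> g"
    proof (rule clamp_profile[of "(\<ge>)" "{1..C-1}" ?p ?t ?a k \<epsilon> g B])
      show "monotone_on {1..C-1} (\<ge>) (\<le>) ?p" "monotone_on {1..C-1} (\<ge>) (\<le>) ?t"
        "monotone_on {1..C-1} (\<ge>) (\<le>) ?a"
        by (auto intro!: monotone_onI monoD[OF mono_cum_lower[OF \<epsilon>(2)]] simp: cum_upper_eq)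
    qed (use k r \<epsilon> in auto)
    \<comment> \<open>A second negation returns to increasing sequences within the original
      bounds.\<close>
    let ?x = "(B, \<lambda>i. - \<tau> i, \<lambda>i. - \<alpha> i)"
    have "mono_on {1..C-1} (\<lambda>i. - \<tau> i)" "mono_on {1..C-1} (\<lambda>i. - \<alpha> i)"
      using *(1,2) by (auto simp: monotone_on_def)
    moreover have "- \<tau> i \<le> cum_upper \<epsilon> P\<^sub>S\<^sub>i i \<and> cum_lower \<epsilon> P\<^sub>S\<^sub>i i \<le> - \<tau> i \<and>
      - \<alpha> i \<le> cum_upper \<epsilon> P\<^sub>N i \<and> cum_lower \<epsilon> P\<^sub>N i \<le> - \<alpha> i \<and> \<bar>\<alpha> i - \<tau> i\<bar> \<le> B \<and>
      - \<alpha> i - cum_lower \<epsilon> P\<^sub>S i \<le> g" if "i \<in> {1..C-1}" for i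
      using *(3-5,7)[OF that] by (auto simp: cum_upper_eq)
    ultimately have "U2_feasible C \<epsilon> P\<^sub>S P\<^sub>S\<^sub>i P\<^sub>N k ?x"
      using r *(6) by (simp add: U2_feasible_iff common_constraints_iff within_bounds_def cum_upper_eq)
    then show ?L
      using *(6) by (intro exI[of _ ?x]) (simp add: U2_gap_def cum_upper_eq)
  qed
qed (use C \<epsilon> in auto)

section \<open>Comparison of the two families under the selection rule\<close>

theorem proposition3:
  fixes C :: nat and \<epsilon> :: real and P\<^sub>S P\<^sub>S\<^sub>i P\<^sub>N :: "nat pmf"
  assumes "C \<ge> 2" and "0 \<le> \<epsilon>" and "\<epsilon> \<le> 1"
    and "set_pmf P\<^sub>S \<subseteq> {1..C}" and "set_pmf P\<^sub>S\<^sub>i \<subseteq> {1..C}" and "set_pmf P\<^sub>N \<subseteq> {1..C}"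
  shows "\<exists>U.
    (\<exists>x. is_arg_max (ks_diff C) (U_feasible C \<epsilon> P\<^sub>S P\<^sub>S\<^sub>i P\<^sub>N) x \<and> ks_diff C x = U) \<and>
    (\<forall>k. U1_solvable C \<epsilon> P\<^sub>S P\<^sub>S\<^sub>i P\<^sub>N k \<longrightarrow> (\<exists>x. U1_solution C \<epsilon> P\<^sub>S P\<^sub>S\<^sub>i P\<^sub>N k x)) \<and>
    (\<forall>k. U2_solvable C \<epsilon> P\<^sub>S P\<^sub>S\<^sub>i P\<^sub>N k \<longrightarrow> (\<exists>x. U2_solution C \<epsilon> P\<^sub>S P\<^sub>S\<^sub>i P\<^sub>N k x)) \<and>
    ((\<exists>k. U1_solvable C \<epsilon> P\<^sub>S P\<^sub>S\<^sub>i P\<^sub>N k) \<or> (\<exists>k. U2_solvable C \<epsilon> P\<^sub>S P\<^sub>S\<^sub>i P\<^sub>N k)) \<and>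
    (\<forall>s\<^sub>1 s\<^sub>2.
      (\<forall>k. U1_solvable C \<epsilon> P\<^sub>S P\<^sub>S\<^sub>i P\<^sub>N k \<longrightarrow> U1_solution C \<epsilon> P\<^sub>S P\<^sub>S\<^sub>i P\<^sub>N k (s\<^sub>1 k)) \<and>
      (\<forall>k. U2_solvable C \<epsilon> P\<^sub>S P\<^sub>S\<^sub>i P\<^sub>N k \<longrightarrow> U2_solution C \<epsilon> P\<^sub>S P\<^sub>S\<^sub>i P\<^sub>N k (s\<^sub>2 k)) \<longrightarrow>
      (\<forall>k\<^sub>1 k\<^sub>2. U1_selected C \<epsilon> P\<^sub>S P\<^sub>S\<^sub>i P\<^sub>N s\<^sub>1 k\<^sub>1 \<and> U2_selected C \<epsilon> P\<^sub>S P\<^sub>S\<^sub>i P\<^sub>N s\<^sub>2 k\<^sub>2 \<longrightarrow>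
        U = (if U1_gap \<epsilon> P\<^sub>S k\<^sub>1 (s\<^sub>1 k\<^sub>1) \<ge> U2_gap \<epsilon> P\<^sub>S k\<^sub>2 (s\<^sub>2 k\<^sub>2)
             then U1_obj \<epsilon> P\<^sub>S k\<^sub>1 (s\<^sub>1 k\<^sub>1) else U2_obj \<epsilon> P\<^sub>S k\<^sub>2 (s\<^sub>2 k\<^sub>2))) \<and>
      ((\<nexists>k. U2_solvable C \<epsilon> P\<^sub>S P\<^sub>S\<^sub>i P\<^sub>N k) \<longrightarrow>
        (\<forall>k\<^sub>1. U1_selected C \<epsilon> P\<^sub>S P\<^sub>S\<^sub>i P\<^sub>N s\<^sub>1 k\<^sub>1 \<longrightarrow> U = U1_obj \<epsilon> P\<^sub>S k\<^sub>1 (s\<^sub>1 k\<^sub>1))) \<and>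
      ((\<nexists>k. U1_solvable C \<epsilon> P\<^sub>S P\<^sub>S\<^sub>i P\<^sub>N k) \<longrightarrow>
        (\<forall>k\<^sub>2. U2_selected C \<epsilon> P\<^sub>S P\<^sub>S\<^sub>i P\<^sub>N s\<^sub>2 k\<^sub>2 \<longrightarrow> U = U2_obj \<epsilon> P\<^sub>S k\<^sub>2 (s\<^sub>2 k\<^sub>2))))"
proof -
  let ?I = "{1..C-1}"
  interpret U1: lp_family ?I \<epsilon> "cum_lower \<epsilon> P\<^sub>S" "cum_lower \<epsilon> P\<^sub>S\<^sub>i" "cum_lower \<epsilon> P\<^sub>N"
    "U1_feasible C \<epsilon> P\<^sub>S P\<^sub>S\<^sub>i P\<^sub>N" "U1_gap \<epsilon> P\<^sub>S"
    using assms(1-3) by (rule U1_lp_family)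
  interpret U2: lp_family ?I \<epsilon> "\<lambda>i. - cum_upper \<epsilon> P\<^sub>S i" "\<lambda>i. - cum_upper \<epsilon> P\<^sub>S\<^sub>i i"
    "\<lambda>i. - cum_upper \<epsilon> P\<^sub>N i" "U2_feasible C \<epsilon> P\<^sub>S P\<^sub>S\<^sub>i P\<^sub>N" "U2_gap \<epsilon> P\<^sub>S"
    using assms(1-3) by (rule U2_lp_family)
  have obj: "U1_obj \<epsilon> P\<^sub>S = U1.obj" "U2_obj \<epsilon> P\<^sub>S = U2.obj"
    by (auto simp: fun_eq_iff U1_obj_def U1.obj_def U1_gap_def U2_obj_def U2.obj_def U2_gap_def)
  have solvable: "U1_solvable C \<epsilon> P\<^sub>S P\<^sub>S\<^sub>i P\<^sub>N = U1.solvable"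
      "U2_solvable C \<epsilon> P\<^sub>S P\<^sub>S\<^sub>i P\<^sub>N = U2.solvable"
    unfolding fun_eq_iff U1_solvable_def U1.solvable_def U2_solvable_def U2.solvable_def by blast+
  have solution: "U1_solution C \<epsilon> P\<^sub>S P\<^sub>S\<^sub>i P\<^sub>N = U1.solution"
      "U2_solution C \<epsilon> P\<^sub>S P\<^sub>S\<^sub>i P\<^sub>N = U2.solution"
    unfolding fun_eq_iff U1_solution_def U1.solution_def U2_solution_def U2.solution_def obj by blast+
  have selected: "U1_selected C \<epsilon> P\<^sub>S P\<^sub>S\<^sub>i P\<^sub>N = U1.selected"
      "U2_selected C \<epsilon> P\<^sub>S P\<^sub>S\<^sub>i P\<^sub>N = U2.selected"
    unfolding fun_eq_iff U1_selected_def U1.selected_def U2_selected_def U2.selected_def obj solvable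
    by blast+
  \<comment> \<open>Passing to negated upper bounds only flips the sign of \<open>t i - a i\<close>,
    as the shift by \<open>\<epsilon>\<close> cancels.\<close>
  have offset: "U2.offset = U1.offset"
    unfolding U1.offset_def U2.offset_def by (simp add: cum_upper_eq abs_minus_commute)

  have ge1: "\<exists>y. U_feasible C \<epsilon> P\<^sub>S P\<^sub>S\<^sub>i P\<^sub>N y \<and> U1.obj k x \<le> ks_diff C y"
    if kx: "k \<in> ?I" "U1_feasible C \<epsilon> P\<^sub>S P\<^sub>S\<^sub>i P\<^sub>N k x" for k x
  proof -
    obtain B \<tau> \<alpha> where x: "x = (B, \<tau>, \<alpha>)"
      by (cases x)
    \<comment> \<open>The sequence of upper bounds itself serves as \<pi>; for the second family it
      is the sequence of lower bounds.\<close>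
    have "within_bounds C \<epsilon> P\<^sub>S (cum_upper \<epsilon> P\<^sub>S)" "mono_on ?I (cum_upper \<epsilon> P\<^sub>S)"
      using assms(2) by (auto simp: within_bounds_def cum_upper_eq
          intro!: monotone_onI monoD[OF mono_cum_lower[OF assms(3)]])
    then obtain y where "U_feasible C \<epsilon> P\<^sub>S P\<^sub>S\<^sub>i P\<^sub>N y"
      "\<bar>cum_upper \<epsilon> P\<^sub>S k - \<alpha> k\<bar> - B \<le> ks_diff C y"
      using U_feasible_ge[OF assms(1,3) kx(1)] kx(2) unfolding x U1_feasible_iff by blast
    then show ?thesis
      by (intro exI[of _ y]) (auto simp: x obj(1)[symmetric] U1_obj_def)
  qed
  have ge2: "\<exists>y. U_feasible C \<epsilon> P\<^sub>S P\<^sub>S\<^sub>i P\<^sub>N y \<and> U2.obj k x \<le> ks_diff C y"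
    if kx: "k \<in> ?I" "U2_feasible C \<epsilon> P\<^sub>S P\<^sub>S\<^sub>i P\<^sub>N k x" for k x
  proof -
    obtain B \<tau> \<alpha> where x: "x = (B, \<tau>, \<alpha>)"
      by (cases x)
    have "within_bounds C \<epsilon> P\<^sub>S (cum_lower \<epsilon> P\<^sub>S)" "mono_on ?I (cum_lower \<epsilon> P\<^sub>S)"
      using assms(2) by (auto simp: within_bounds_def cum_upper_eq
          intro!: monotone_onI monoD[OF mono_cum_lower[OF assms(3)]])
    then obtain y where "U_feasible C \<epsilon> P\<^sub>S P\<^sub>S\<^sub>i P\<^sub>N y"
      "\<bar>cum_lower \<epsilon> P\<^sub>S k - \<alpha> k\<bar> - B \<le> ks_diff C y"
      using U_feasible_ge[OF assms(1,3) kx(1)] kx(2) unfolding x U2_feasible_iff by blast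
    then show ?thesis
      by (intro exI[of _ y]) (auto simp: x obj(2)[symmetric] U2_obj_def)
  qed
  note le = U_feasible_le[OF assms(1), of \<epsilon> P\<^sub>S P\<^sub>S\<^sub>i P\<^sub>N, unfolded obj]

  \<comment> \<open>The lower bounds, completed by 1 at \<open>C\<close>, form an admissible triple,
    which \<open>le\<close> carries into one of the programs.\<close>
  have some_solvable: "(\<exists>k. U1.solvable k) \<or> (\<exists>k. U2.solvable k)"
  proof -
    have "within_bounds C \<epsilon> P (cum_lower \<epsilon> P)" "mono_on ?I (cum_lower \<epsilon> P)" for P
      using assms(2) mono_cum_lower[OF assms(3)]
      by (auto simp: within_bounds_def cum_upper_eq intro: monotone_on_subset)
    from cumulative_distribution_extend[OF assms(1,3) this]
    have "U_feasible C \<epsilon> P\<^sub>S P\<^sub>S\<^sub>i P\<^sub>N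
        ((cum_lower \<epsilon> P\<^sub>S)(C := 1), (cum_lower \<epsilon> P\<^sub>S\<^sub>i)(C := 1), (cum_lower \<epsilon> P\<^sub>N)(C := 1))"
      by (simp add: U_feasible_def)
    from le[OF this] show ?thesis
      unfolding U1.solvable_def U2.solvable_def by blast
  qed

  \<comment> \<open>Attainment is inherited from the programs: \<open>le\<close> bounds the original
    problem by \<open>v\<close>, and \<open>ge1\<close> or \<open>ge2\<close> reaches
    \<open>v\<close>.\<close>
  have U_exists: "\<exists>y. is_arg_max (ks_diff C) (U_feasible C \<epsilon> P\<^sub>S P\<^sub>S\<^sub>i P\<^sub>N) y \<and> ks_diff C y = v"
    if v: "(\<exists>k x. U1.best k x \<and> v = U1.obj k x) \<or> (\<exists>k x. U2.best k x \<and> v = U2.obj k x)"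
      and v1: "\<And>k x. U1.best k x \<Longrightarrow> U1.obj k x \<le> v"
      and v2: "\<And>k x. U2.best k x \<Longrightarrow> U2.obj k x \<le> v" for v
  proof -
    have le1: "U1.obj k x \<le> v" if "k \<in> ?I" "U1_feasible C \<epsilon> P\<^sub>S P\<^sub>S\<^sub>i P\<^sub>N k x" for k x
    proof -
      have "U1.solvable k"
        using that unfolding U1.solvable_def by blast
      then obtain j z where "U1.best j z"
        using U1.best_exists by blast
      then show ?thesis
        using v1[of j z] U1.bestD(3)[of j z k x] that by simp
    qed
    have le2: "U2.obj k x \<le> v" if "k \<in> ?I" "U2_feasible C \<epsilon> P\<^sub>S P\<^sub>S\<^sub>i P\<^sub>N k x" for k x
    proof -
      have "U2.solvable k"
        using that unfolding U2.solvable_def by blast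
      then obtain j z where "U2.best j z"
        using U2.best_exists by blast
      then show ?thesis
        using v2[of j z] U2.bestD(3)[of j z k x] that by simp
    qed
    have bound: "ks_diff C y \<le> v" if "U_feasible C \<epsilon> P\<^sub>S P\<^sub>S\<^sub>i P\<^sub>N y" for y
      using le[OF that] le1 le2 by (meson order_trans)
    obtain y where y: "U_feasible C \<epsilon> P\<^sub>S P\<^sub>S\<^sub>i P\<^sub>N y" "v \<le> ks_diff C y"
      using v ge1[OF U1.bestD(1,2)] ge2[OF U2.bestD(1,2)] by metis
    then have "ks_diff C y = v"
      using bound by (intro antisym)
    then show ?thesis
      using y bound unfolding is_arg_max_linorder by blast
  qed

  have best_eq1: "U1.obj k x = U1.obj j z" if "U1.best k x" "U1.best j z" for k x j z
    using that by (meson U1.bestD antisym)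
  have best_eq2: "U2.obj k x = U2.obj j z" if "U2.best k x" "U2.best j z" for k x j z
    using that by (meson U2.bestD antisym)
  have best_solvable: "U1.best k x \<Longrightarrow> U1.solvable k" "U2.best k x \<Longrightarrow> U2.solvable k" for k x
    unfolding U1.best_def U1.solvable_def U2.best_def U2.solvable_def by blast+

  \<comment> \<open>\<open>v\<close> is the larger of the two family optima, or the only one if the
    other family has no solvable program.\<close>
  obtain v where v: "(\<exists>k x. U1.best k x \<and> v = U1.obj k x) \<or> (\<exists>k x. U2.best k x \<and> v = U2.obj k x)"
    "\<And>k x. U1.best k x \<Longrightarrow> U1.obj k x \<le> v" "\<And>k x. U2.best k x \<Longrightarrow> U2.obj k x \<le> v"
  proof -
    have "(\<exists>k x. U1.best k x) \<or> (\<exists>j z. U2.best j z)"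
      using some_solvable U1.best_exists U2.best_exists by metis
    then consider k x j z where "U1.best k x" "U2.best j z"
      | k x where "U1.best k x" "\<nexists>j z. U2.best j z" | j z where "U2.best j z" "\<nexists>k x. U1.best k x"
      by blast
    then show thesis
    proof cases
      case 1
      show ?thesis
      proof (rule that[of "max (U1.obj k x) (U2.obj j z)"])
        have "max (U1.obj k x) (U2.obj j z) \<in> {U1.obj k x, U2.obj j z}"
          by (simp add: max_def)
        then show "(\<exists>i y. U1.best i y \<and> max (U1.obj k x) (U2.obj j z) = U1.obj i y) \<or>
          (\<exists>i y. U2.best i y \<and> max (U1.obj k x) (U2.obj j z) = U2.obj i y)"
          using 1 by blast
        show "U1.obj i y \<le> max (U1.obj k x) (U2.obj j z)" if "U1.best i y" for i y
          using best_eq1[OF that 1(1)] by simp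
        show "U2.obj i y \<le> max (U1.obj k x) (U2.obj j z)" if "U2.best i y" for i y
          using best_eq2[OF that 1(2)] by simp
      qed
    next
      case 2
      show ?thesis
      proof (rule that[of "U1.obj k x"])
        show "(\<exists>i y. U1.best i y \<and> U1.obj k x = U1.obj i y) \<or>
          (\<exists>i y. U2.best i y \<and> U1.obj k x = U2.obj i y)"
          using 2 by blast
        show "U1.obj i y \<le> U1.obj k x" if "U1.best i y" for i y
          using best_eq1[OF that 2(1)] by simp
        show "U2.obj i y \<le> U1.obj k x" if "U2.best i y" for i y
          using 2 that by blast
      qed
    next
      case 3
      show ?thesis
      proof (rule that[of "U2.obj j z"])
        show "(\<exists>i y. U1.best i y \<and> U2.obj j z = U1.obj i y) \<or>
          (\<exists>i y. U2.best i y \<and> U2.obj j z = U2.obj i y)"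
          using 3 by blast
        show "U2.obj i y \<le> U2.obj j z" if "U2.best i y" for i y
          using best_eq2[OF that 3(1)] by simp
        show "U1.obj i y \<le> U2.obj j z" if "U1.best i y" for i y
          using 3 that by blast
      qed
    qed
  qed

  have only1: "v = U1.obj k (s k)"
    if "\<And>k. U1.solvable k \<Longrightarrow> U1.solution k (s k)" "\<nexists>k. U2.solvable k" "U1.selected s k" for s k
    using v(1) best_solvable(2) that(2) best_eq1[OF _ U1.best_selected[OF that(1,3)]] by blast
  have only2: "v = U2.obj k (s k)"
    if "\<And>k. U2.solvable k \<Longrightarrow> U2.solution k (s k)" "\<nexists>k. U1.solvable k" "U2.selected s k" for s k
    using v(1) best_solvable(1) that(2) best_eq2[OF _ U2.best_selected[OF that(1,3)]] by blast
  have main: "v = (if U1_gap \<epsilon> P\<^sub>S k\<^sub>1 (s\<^sub>1 k\<^sub>1) \<ge> U2_gap \<epsilon> P\<^sub>S k\<^sub>2 (s\<^sub>2 k\<^sub>2)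
      then U1.obj k\<^sub>1 (s\<^sub>1 k\<^sub>1) else U2.obj k\<^sub>2 (s\<^sub>2 k\<^sub>2))"
    if s1: "\<And>k. U1.solvable k \<Longrightarrow> U1.solution k (s\<^sub>1 k)"
      and s2: "\<And>k. U2.solvable k \<Longrightarrow> U2.solution k (s\<^sub>2 k)"
      and sel: "U1.selected s\<^sub>1 k\<^sub>1" "U2.selected s\<^sub>2 k\<^sub>2" for s\<^sub>1 s\<^sub>2 k\<^sub>1 k\<^sub>2
  proof -
    define u\<^sub>1 where "u\<^sub>1 = U1.obj k\<^sub>1 (s\<^sub>1 k\<^sub>1)"
    define u\<^sub>2 where "u\<^sub>2 = U2.obj k\<^sub>2 (s\<^sub>2 k\<^sub>2)"
    have best: "U1.best k\<^sub>1 (s\<^sub>1 k\<^sub>1)" "U2.best k\<^sub>2 (s\<^sub>2 k\<^sub>2)"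
      using U1.best_selected[OF s1 sel(1)] U2.best_selected[OF s2 sel(2)] by auto
    have "v = u\<^sub>1 \<or> v = u\<^sub>2"
      using v(1) best_eq1[OF _ best(1)] best_eq2[OF _ best(2)] unfolding u\<^sub>1_def u\<^sub>2_def by metis
    then have v_max: "v = max u\<^sub>1 u\<^sub>2"
      using v(2)[OF best(1)] v(3)[OF best(2)] unfolding u\<^sub>1_def u\<^sub>2_def by linarith
    have gap: "U1_gap \<epsilon> P\<^sub>S k\<^sub>1 (s\<^sub>1 k\<^sub>1) = max 0 (u\<^sub>1 + U1.offset)"
      "U2_gap \<epsilon> P\<^sub>S k\<^sub>2 (s\<^sub>2 k\<^sub>2) = max 0 (u\<^sub>2 + U1.offset)"
      using U1.gap_selected[OF s1 sel(1)] U2.gap_selected[OF s2 sel(2)]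
      unfolding u\<^sub>1_def u\<^sub>2_def offset by simp_all
    \<comment> \<open>At a common index the two lower bounds on \<open>u\<^sub>1 + U1.offset\<close>
      and \<open>u\<^sub>2 + U1.offset\<close> are opposite numbers. So if both gaps are 0, both
      sums vanish and \<open>u\<^sub>1 = u\<^sub>2\<close>; otherwise the larger gap belongs to the
      larger value.\<close>
    define i :: nat where "i = 1"
    have "i \<in> ?I"
      using assms(1) by (simp add: i_def)
    then have "cum_lower \<epsilon> P\<^sub>S i - cum_lower \<epsilon> P\<^sub>N i \<le> u\<^sub>1 + U1.offset"
      "cum_lower \<epsilon> P\<^sub>N i - cum_lower \<epsilon> P\<^sub>S i \<le> u\<^sub>2 + U1.offset"
      using U1.best_value_ge[OF best(1), of i] U2.best_value_ge[OF best(2), of i]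
        cum_upper_eq[of \<epsilon> P\<^sub>S i] cum_upper_eq[of \<epsilon> P\<^sub>N i]
      unfolding u\<^sub>1_def u\<^sub>2_def offset by linarith+
    then show ?thesis
      unfolding gap v_max u\<^sub>1_def[symmetric] u\<^sub>2_def[symmetric] by (auto simp: max_def)
  qed

  show ?thesis
    unfolding obj solvable solution selected
  proof (intro exI[of _ v] conjI allI impI)
    show "\<exists>x. is_arg_max (ks_diff C) (U_feasible C \<epsilon> P\<^sub>S P\<^sub>S\<^sub>i P\<^sub>N) x \<and> ks_diff C x = v"
      using U_exists v by blast
  qed ((rule U1.solution_exists, assumption), (rule U2.solution_exists, assumption),
      rule some_solvable, (rule main; blast), (rule only1; blast), (rule only2; blast))
qed

end
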